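(* The Thue-Morse word $\mathbf{T}=011010011001\cdots$, i.e. the fixed point beginning with $0$ of the substitution $\tau$ defined by $0\mapsto 01$, $1\mapsto 10$, is self-shuffling.
   Context: $\mathbb{N}=\{0,1,2,\dots\}$. For a finite non-empty set $\mathbb{A}$, $\mathbb{A}^*$ is the set of finite words (including the empty word) and $\mathbb{A}^{\mathbb{N}}$ the set of one-sided infinite words over $\mathbb{A}$. An infinite word $x\in\mathbb{A}^{\mathbb{N}}$ is self-shuffling if there exist finite words $U_i,V_i\in\mathbb{A}^*$ ($i\ge 0$) with $x=\prod_{i=0}^\infty U_iV_i=\prod_{i=0}^\infty U_i=\prod_{i=0}^\infty V_i$. Equivalently, there is a partition of $\mathbb{N}$ into two infinite sets $N^1,N^2$ such that $x[N^1]=x[N^2]=x$, where for $N=\{N_0<N_1<\cdots\}\subseteq\mathbb{N}$ and $x=x_0x_1x_2\cdots$ one puts $x[N]=x_{N_0}x_{N_1}x_{N_2}\cdots$. *)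

theory Defs
  imports Main "HOL-Library.Z2"
begin

text \<open>An infinite word over an alphabet is a function on the naturals, a finite word is a list.
  The predicate \<open>is_prod W x\<close> says that the infinite word \<open>x\<close> is the product
  \<open>W 0 W 1 W 2 \<dots>\<close> of the finite words \<open>W i\<close>. Single factors may be empty; the
  second conjunct says that the product is not a finite word.\<close>

definition is_prod :: "(nat \<Rightarrow> 'a list) \<Rightarrow> (nat \<Rightarrow> 'a) \<Rightarrow> bool" where
  "is_prod W x \<longleftrightarrow>
     (\<forall>n. let p = concat (map W [0..<n]) in p = map x [0..<length p]) \<and>
     (\<forall>m. \<exists>n. m \<le> length (concat (map W [0..<n])))"

definition self_shuffling :: "(nat \<Rightarrow> 'a) \<Rightarrow> bool" where
  "self_shuffling x \<longleftrightarrow>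
     (\<exists>U V. is_prod (\<lambda>i. U i @ V i) x \<and> is_prod U x \<and> is_prod V x)"

text \<open>The binary alphabet is the two-element type \<open>bit\<close>.\<close>

definition tau :: "bit \<Rightarrow> bit list" where
  "tau a = (if a = 0 then [0, 1] else [1, 0])"

text \<open>A substitution acts letterwise on infinite words, so \<open>x\<close> is fixed by \<open>s\<close> iff it is the
  product of the words \<open>s (x i)\<close>.\<close>

definition fixed_point :: "('a \<Rightarrow> 'a list) \<Rightarrow> (nat \<Rightarrow> 'a) \<Rightarrow> bool" where
  "fixed_point s x \<longleftrightarrow> is_prod (\<lambda>i. s (x i)) x"

definition thue_morse :: "nat \<Rightarrow> bit" where
  "thue_morse = (THE x. fixed_point tau x \<and> x 0 = 0)"

text \<open>The rest of the theory shows that this description determines a word.\<close>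

lemma length_concat_tau: "length (concat (map (\<lambda>i. tau (x i)) [0..<n])) = 2 * n"
  by (induction n) (auto simp: tau_def)

lemma fixed_point_tau_iff:
  "fixed_point tau x \<longleftrightarrow> (\<forall>n. tau (x n) = [x (2 * n), x (2 * n + 1)])"
proof
  assume "fixed_point tau x"
  then have *: "concat (map (\<lambda>i. tau (x i)) [0..<n]) = map x [0..<2 * n]" for n
    by (simp only: fixed_point_def is_prod_def Let_def length_concat_tau)
  show "\<forall>n. tau (x n) = [x (2 * n), x (2 * n + 1)]"
  proof
    fix n
    show "tau (x n) = [x (2 * n), x (2 * n + 1)]"
      using *[of "Suc n"] *[of n] by simp
  qed
next
  assume *: "\<forall>n. tau (x n) = [x (2 * n), x (2 * n + 1)]"
  have "concat (map (\<lambda>i. tau (x i)) [0..<n]) = map x [0..<2 * n]" for n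
    by (induction n) (auto simp: *)
  moreover have "\<exists>n. m \<le> 2 * n" for m :: nat
    by (rule exI[of _ m]) simp
  ultimately show "fixed_point tau x"
    by (simp only: fixed_point_def is_prod_def Let_def length_concat_tau) simp
qed

fun tm_rec :: "nat \<Rightarrow> bit" where
  "tm_rec n = (if n = 0 then 0 else tau (tm_rec (n div 2)) ! (n mod 2))"

declare tm_rec.simps [simp del]

lemma ex1_thue_morse: "\<exists>!x. fixed_point tau x \<and> x 0 = 0"
proof (rule ex1I[of _ tm_rec])
  have "tm_rec (2 * n) = tau (tm_rec n) ! 0" for n
    by (cases "n = 0") (simp_all add: tm_rec.simps[of "2 * n"] tm_rec.simps[of 0] tau_def)
  moreover have "tm_rec (2 * n + 1) = tau (tm_rec n) ! 1" for n
    by (simp add: tm_rec.simps[of "Suc (2 * n)"])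
  ultimately show "fixed_point tau tm_rec \<and> tm_rec 0 = 0"
    by (auto simp: fixed_point_tau_iff tm_rec.simps[of 0] tau_def)
next
  fix x :: "nat \<Rightarrow> bit"
  assume x: "fixed_point tau x \<and> x 0 = 0"
  then have fx: "tau (x n) = [x (2 * n), x (2 * n + 1)]" for n
    by (simp only: fixed_point_tau_iff)
  have "x n = tm_rec n" for n
  proof (induction n rule: less_induct)
    case (less n)
    show ?case
    proof (cases "n = 0")
      case True
      with x show ?thesis by (simp add: tm_rec.simps)
    next
      case False
      then have "x (n div 2) = tm_rec (n div 2)"
        by (intro less.IH) simp
      with False have "tm_rec n = [x (2 * (n div 2)), x (2 * (n div 2) + 1)] ! (n mod 2)"
        using fx[of "n div 2"] by (simp add: tm_rec.simps[of n])
      then show ?thesis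
        by (cases "even n") (simp_all add: odd_iff_mod_2_eq_one even_iff_mod_2_eq_zero mult_div_mod_eq)
    qed
  qed
  then show "x = tm_rec" by blast
qed

lemma thue_morse_fixed_point: "fixed_point tau thue_morse" "thue_morse 0 = 0"
  using theI'[OF ex1_thue_morse] unfolding thue_morse_def by blast+

end

theory Submission
  imports Defs
begin

text \<open>
  A shuffle of a word \<open>x\<close> with itself is a lattice path: the point \<open>(i, j)\<close> records that \<open>i\<close>
  letters of the first copy and \<open>j\<close> letters of the second copy have been used, so that \<open>i + j\<close>
  letters of the shuffled word have been written. A pair of factors \<open>U\<^sub>n V\<^sub>n\<close> moves from a point
  \<open>(i, j)\<close> to a point \<open>(i', j')\<close>, and this move is legal iff
  \<open>x[i + j, i' + j') = x[i, i') x[j, j')\<close>. The word is self-shuffling iff an infinite path of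
  legal moves starts at the origin and has both coordinates unbounded.

  The substitution \<open>\<tau>\<close> maps each letter to two letters and fixes the Thue-Morse word, hence doubling
  all coordinates of a legal move gives a legal move (\<open>shuffle_move_double\<close>). It is therefore
  enough to find one finite legal path that leads from the origin to a point \<open>(a, b)\<close> with
  \<open>a, b > 0\<close> and from there to \<open>(2 a, 2 b)\<close>: the last part of it can be repeated for ever at doubled
  scale. The path
  \<open>(0, 0) \<rightarrow> (0, 6) \<rightarrow> (4, 7) \<rightarrow> (6, 9) \<rightarrow> (8, 14)\<close>
  has this property with \<open>(a, b) = (4, 7)\<close>. Its four moves concern only the first 22 letters and
  read \<open>\<epsilon>\<cdot>011010\<close>, \<open>0110\<cdot>0\<close>, \<open>10\<cdot>11\<close> and \<open>01\<cdot>00101\<close>.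
\<close>

definition shuffle_move :: "(nat \<Rightarrow> 'a) \<Rightarrow> nat \<times> nat \<Rightarrow> nat \<times> nat \<Rightarrow> bool" where
  "shuffle_move x p q \<longleftrightarrow> fst p \<le> fst q \<and> snd p \<le> snd q \<and>
     map x [fst p + snd p..<fst q + snd q] =
     map x [fst p..<fst q] @ map x [snd p..<snd q]"

lemma is_prod_consecutive_factors:
  fixes x :: "nat \<Rightarrow> 'a" and c :: "nat \<Rightarrow> nat"
  assumes "c 0 = 0" and mono: "\<And>n. c n \<le> c (Suc n)" and unbounded: "\<And>m. \<exists>n. m \<le> c n"
  shows "is_prod (\<lambda>n. map x [c n..<c (Suc n)]) x"
proof -
  have "concat (map (\<lambda>n. map x [c n..<c (Suc n)]) [0..<n]) = map x [0..<c n]" for n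
  proof (induction n)
    case 0
    show ?case by (simp add: \<open>c 0 = 0\<close>)
  next
    case (Suc n)
    have "[0..<c (Suc n)] = [0..<c n] @ [c n..<c (Suc n)]"
      using upt_add_eq_append[of 0 "c n" "c (Suc n) - c n"] mono[of n] by simp
    with Suc.IH show ?case by simp
  qed
  then show ?thesis
    using unbounded by (simp add: is_prod_def Let_def)
qed

lemma self_shuffling_if_path:
  fixes x :: "nat \<Rightarrow> 'a" and p :: "nat \<Rightarrow> nat \<times> nat"
  assumes start: "p 0 = (0, 0)" and move: "\<And>n. shuffle_move x (p n) (p (Suc n))"
    and unbounded: "\<And>m. \<exists>n. m \<le> fst (p n)" "\<And>m. \<exists>n. m \<le> snd (p n)"
  shows "self_shuffling x"
proof -
  define U where "U = (\<lambda>n. map x [fst (p n)..<fst (p (Suc n))])"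
  define V where "V = (\<lambda>n. map x [snd (p n)..<snd (p (Suc n))])"
  have mono: "fst (p n) \<le> fst (p (Suc n))" "snd (p n) \<le> snd (p (Suc n))" for n
    using move[of n] by (simp_all add: shuffle_move_def)
  have "is_prod U x"
    unfolding U_def
    by (rule is_prod_consecutive_factors[where c = "\<lambda>n. fst (p n)"])
      (use start mono unbounded in simp_all)
  moreover have "is_prod V x"
    unfolding V_def
    by (rule is_prod_consecutive_factors[where c = "\<lambda>n. snd (p n)"])
      (use start mono unbounded in simp_all)
  moreover have "is_prod (\<lambda>n. U n @ V n) x"
  proof -
    have "\<exists>n. m \<le> fst (p n) + snd (p n)" for m
      using unbounded(1)[of m] trans_le_add1 by blast
    then have "is_prod (\<lambda>n. map x [fst (p n) + snd (p n)..<fst (p (Suc n)) + snd (p (Suc n))]) x"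
      by (intro is_prod_consecutive_factors[where c = "\<lambda>n. fst (p n) + snd (p n)"])
        (use start mono in \<open>simp_all add: add_mono\<close>)
    then show ?thesis
      using move by (simp add: U_def V_def shuffle_move_def)
  qed
  ultimately show ?thesis
    unfolding self_shuffling_def by blast
qed

lemma fixed_point_tau_factor:
  assumes "fixed_point tau x" and "i \<le> j"
  shows "map x [2 * i..<2 * j] = concat (map tau (map x [i..<j]))"
  using \<open>i \<le> j\<close>
proof (induction j rule: dec_induct)
  case base
  show ?case by simp
next
  case (step j)
  have "tau (x j) = [x (2 * j), x (2 * j + 1)]"
    using assms(1) by (simp add: fixed_point_tau_iff)
  with step show ?case by simp
qed

text \<open>
  Applying \<open>\<tau>\<close> to both sides of the word equation behind a move doubles the bounds of all three
  factors in it.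
\<close>

lemma shuffle_move_double:
  assumes fp: "fixed_point tau x" and move: "shuffle_move x p q"
  shows "shuffle_move x (2 * fst p, 2 * snd p) (2 * fst q, 2 * snd q)"
proof -
  obtain i j i' j' where pq: "p = (i, j)" "q = (i', j')"
    by fastforce
  have le: "i \<le> i'" "j \<le> j'"
    and eq: "map x [i + j..<i' + j'] = map x [i..<i'] @ map x [j..<j']"
    using move by (simp_all add: shuffle_move_def pq)
  have "map x [2 * (i + j)..<2 * (i' + j')] = concat (map tau (map x [i + j..<i' + j']))"
    by (rule fixed_point_tau_factor[OF fp]) (use le in simp)
  also have "\<dots> = map x [2 * i..<2 * i'] @ map x [2 * j..<2 * j']"
    by (simp only: eq map_append concat_append fixed_point_tau_factor[OF fp] le)
  finally show ?thesis
    using le by (simp add: shuffle_move_def distrib_left pq)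
qed

text \<open>
  The self-similar part starts at \<open>(4, 7)\<close>, since points on the axes cannot seed it: doubling fixes
  the origin and never makes the first coordinate of \<open>(0, 6)\<close> positive.
\<close>

fun tm_path :: "nat \<Rightarrow> nat \<times> nat" where
  "tm_path 0 = (0, 0)"
| "tm_path (Suc 0) = (0, 6)"
| "tm_path (Suc (Suc 0)) = (4, 7)"
| "tm_path (Suc (Suc (Suc 0))) = (6, 9)"
| "tm_path (Suc (Suc (Suc (Suc n)))) =
     (2 * fst (tm_path (Suc (Suc n))), 2 * snd (tm_path (Suc (Suc n))))"

lemma thue_morse_double:
  "thue_morse (2 * n) = thue_morse n"
  "thue_morse (Suc (2 * n)) = thue_morse n + 1"
proof -
  have "tau (thue_morse n) = [thue_morse (2 * n), thue_morse (2 * n + 1)]"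
    using thue_morse_fixed_point(1) by (simp add: fixed_point_tau_iff)
  then show "thue_morse (2 * n) = thue_morse n" "thue_morse (Suc (2 * n)) = thue_morse n + 1"
    by (cases "thue_morse n"; simp add: tau_def)+
qed

lemma thue_morse_numeral:
  "thue_morse (Suc 0) = 1"
  "thue_morse (numeral (num.Bit0 k)) = thue_morse (numeral k)"
  "thue_morse (numeral (num.Bit1 k)) = thue_morse (numeral k) + 1"
  using thue_morse_double[of 0] thue_morse_double[of "numeral k"] thue_morse_fixed_point(2)
  by (simp_all add: numeral_Bit0 numeral_Bit1 mult_2)

lemma tm_path_move: "shuffle_move thue_morse (tm_path n) (tm_path (Suc n))"
proof (induction n rule: tm_path.induct)
  case 2
  \<comment> \<open>The equations for \<open>thue_morse\<close> at numerals need the indices as numerals, while simplification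
    unfolds an interval with lower bound 0 to iterated successors.\<close>
  have "[0..<4] = [0, 1, 2, 3]"
    by (simp add: upt_conv_Cons)
  then show ?case
    by (simp add: shuffle_move_def thue_morse_numeral thue_morse_fixed_point(2))
next
  case (5 n)
  then show ?case
    using shuffle_move_double[OF thue_morse_fixed_point(1)] by (simp only: tm_path.simps(5))
qed (simp_all add: shuffle_move_def thue_morse_numeral)

lemma tm_path_ge: "n \<le> fst (tm_path (Suc (Suc n))) \<and> n \<le> snd (tm_path (Suc (Suc n)))"
  by (induction n rule: tm_path.induct) auto

theorem theorem3p1:
  shows "self_shuffling thue_morse"
proof (rule self_shuffling_if_path)
  show "tm_path 0 = (0, 0)" by simp
  show "shuffle_move thue_morse (tm_path n) (tm_path (Suc n))" for n
    by (rule tm_path_move)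
  show "\<exists>n. m \<le> fst (tm_path n)" "\<exists>n. m \<le> snd (tm_path n)" for m
    using tm_path_ge by blast+
qed

end
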